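(* The positive integers that are expressible both as a sum of successive odd positive numbers and as a sum of successive even positive numbers are exactly the even numbers of the form $2^{n+1}\cdot(2m+1)$, where $m$ and $n$ are positive integers.
   Context: A sum of successive odd (respectively even) positive numbers is a sum $a+(a+2)+(a+4)+\cdots+(a+2(r-1))$ with $r\ge 2$ terms, where $a$ is an odd (respectively even) positive integer. *)

theory Defs
  imports Main
begin

definition sum_successive_odds :: "nat \<Rightarrow> bool" where
  "sum_successive_odds N \<longleftrightarrow>
     (\<exists>a r. odd a \<and> a > 0 \<and> r \<ge> 2 \<and> N = (\<Sum>i<r. a + 2 * i))"

definition sum_successive_evens :: "nat \<Rightarrow> bool" where
  "sum_successive_evens N \<longleftrightarrow>
     (\<exists>a r. even a \<and> a > 0 \<and> r \<ge> 2 \<and> N = (\<Sum>i<r. a + 2 * i))"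

end

theory Submission
  imports Defs
begin

text \<open>
  The arithmetic progression \<open>a, a + 2, \<dots>\<close> with \<open>r\<close> terms has sum \<open>r * (a + r - 1)\<close>. Writing
  \<open>s = a + r - 1\<close> turns both conditions into conditions on factorizations \<open>N = r * s\<close> with
  \<open>2 \<le> r \<le> s\<close>: the summands are odd when \<open>r\<close> and \<open>s\<close> have the same parity, and even when they
  have opposite parity (\<open>sum_successive_odds_iff\<close>, \<open>sum_successive_evens_iff\<close>).

  If \<open>N\<close> has factorizations of both kinds, the one of opposite parity makes \<open>N\<close> even and gives it
  an odd divisor greater than 1. As \<open>N\<close> is even, the two factors of equal parity must
  both be even, so 4 divides \<open>N\<close>; hence the odd part of \<open>N\<close> exceeds 1 and \<open>N\<close> contains
  at least two factors 2, which is the claimed form.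

  Conversely, \<open>2 ^ (n + 1) * (2 * m + 1)\<close> with \<open>m, n > 0\<close> factors as
  \<open>2 * (2 ^ n * (2 * m + 1))\<close>, with both factors even, and as it stands, with factors of opposite
  parity, where the smaller one serves as \<open>r\<close>.
\<close>

lemma sum_progression_step_two:
  fixes a r :: nat
  assumes "r > 0"
  shows "(\<Sum>i<r. a + 2 * i) = r * (a + r - 1)"
  using assms
proof (induction r rule: nat_induct_non_zero)
  case 1
  show ?case by simp
next
  case (Suc r)
  then show ?case by (cases r) (simp_all add: algebra_simps)
qed

text \<open>
  Conversely to \<open>s = a + r - 1\<close>, a factorization determines the first summand
  \<open>a = s - r + 1\<close>; it is positive because \<open>r \<le> s\<close>, and its parity is opposite to that of
  \<open>s - r\<close>.
\<close>

lemma sum_successive_odds_iff: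
  "sum_successive_odds N \<longleftrightarrow> (\<exists>r s. N = r * s \<and> 2 \<le> r \<and> r \<le> s \<and> (even r \<longleftrightarrow> even s))"
proof
  assume "sum_successive_odds N"
  then obtain a r where ar: "odd a" "a > 0" "r \<ge> 2" and "N = (\<Sum>i<r. a + 2 * i)"
    unfolding sum_successive_odds_def by blast
  then have "N = r * (a + r - 1)"
    using sum_progression_step_two[of r a] by simp
  moreover have "r \<le> a + r - 1" "even r \<longleftrightarrow> even (a + r - 1)"
    using ar by auto
  ultimately show "\<exists>r s. N = r * s \<and> 2 \<le> r \<and> r \<le> s \<and> (even r \<longleftrightarrow> even s)"
    using \<open>r \<ge> 2\<close> by blast
next
  assume "\<exists>r s. N = r * s \<and> 2 \<le> r \<and> r \<le> s \<and> (even r \<longleftrightarrow> even s)"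
  then obtain r s where rs: "N = r * s" "2 \<le> r" "r \<le> s" "even r \<longleftrightarrow> even s"
    by blast
  have "s - r + 1 + r - 1 = s" "r > 0" using rs(2,3) by simp_all
  then have "N = (\<Sum>i<r. (s - r + 1) + 2 * i)"
    using sum_progression_step_two[of r "s - r + 1"] rs(1) by (simp only:)
  moreover have "odd (s - r + 1)" "s - r + 1 > 0"
    using rs by auto
  ultimately show "sum_successive_odds N"
    unfolding sum_successive_odds_def using \<open>2 \<le> r\<close>
    by (intro exI[of _ "s - r + 1"] exI[of _ r] conjI)
qed

lemma sum_successive_evens_iff:
  "sum_successive_evens N \<longleftrightarrow> (\<exists>r s. N = r * s \<and> 2 \<le> r \<and> r \<le> s \<and> (even r \<longleftrightarrow> odd s))"
proof
  assume "sum_successive_evens N"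
  then obtain a r where ar: "even a" "a > 0" "r \<ge> 2" and "N = (\<Sum>i<r. a + 2 * i)"
    unfolding sum_successive_evens_def by blast
  then have "N = r * (a + r - 1)"
    using sum_progression_step_two[of r a] by simp
  moreover have "r \<le> a + r - 1" "even r \<longleftrightarrow> odd (a + r - 1)"
    using ar by auto
  ultimately show "\<exists>r s. N = r * s \<and> 2 \<le> r \<and> r \<le> s \<and> (even r \<longleftrightarrow> odd s)"
    using \<open>r \<ge> 2\<close> by blast
next
  assume "\<exists>r s. N = r * s \<and> 2 \<le> r \<and> r \<le> s \<and> (even r \<longleftrightarrow> odd s)"
  then obtain r s where rs: "N = r * s" "2 \<le> r" "r \<le> s" "even r \<longleftrightarrow> odd s"
    by blast
  have "s - r + 1 + r - 1 = s" "r > 0" using rs(2,3) by simp_all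
  then have "N = (\<Sum>i<r. (s - r + 1) + 2 * i)"
    using sum_progression_step_two[of r "s - r + 1"] rs(1) by (simp only:)
  moreover have "even (s - r + 1)" "s - r + 1 > 0"
    using rs by auto
  ultimately show "sum_successive_evens N"
    unfolding sum_successive_evens_def using \<open>2 \<le> r\<close>
    by (intro exI[of _ "s - r + 1"] exI[of _ r] conjI)
qed

lemma power_of_two_times_odd:
  fixes n :: nat
  assumes "n > 0"
  shows "\<exists>k u. n = 2 ^ k * u \<and> odd u"
  using assms
proof (induction n rule: less_induct)
  case (less n)
  show ?case
  proof (cases "even n")
    case True
    then obtain h where h: "n = 2 * h" by blast
    then obtain k u where "h = 2 ^ k * u" "odd u"
      using less.IH[of h] less.prems by auto
    then have "n = 2 ^ Suc k * u \<and> odd u" using h by simp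
    then show ?thesis by blast
  next
    case False
    then have "n = 2 ^ 0 * n \<and> odd n" by simp
    then show ?thesis by blast
  qed
qed

theorem mainTheorem5:
  "{N :: nat. N > 0 \<and> sum_successive_odds N \<and> sum_successive_evens N} =
   {2 ^ (n + 1) * (2 * m + 1) | m n :: nat. m > 0 \<and> n > 0}"
proof (intro equalityI subsetI)
  fix N :: nat
  assume "N \<in> {N. N > 0 \<and> sum_successive_odds N \<and> sum_successive_evens N}"
  then have "N > 0" "sum_successive_odds N" "sum_successive_evens N" by auto
  then obtain r s p' q' where rs: "N = r * s" "even r \<longleftrightarrow> even s"
    and pq': "N = p' * q'" "2 \<le> p'" "p' \<le> q'" "even p' \<longleftrightarrow> odd q'"
    unfolding sum_successive_odds_iff sum_successive_evens_iff by blast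
  obtain p q where pq: "N = p * q" "even p" "odd q" "q \<ge> 2"
  proof (cases "even p'")
    case True
    then show ?thesis using pq' that[of p' q'] by simp
  next
    case False
    then show ?thesis using pq' that[of q' p'] by (simp add: mult.commute)
  qed
  have "even N" using pq by simp
  then have "even r" "even s" using rs by auto
  then have "4 dvd N" using rs mult_dvd_mono[of 2 r 2 s] by simp
  have "p > 0" using \<open>N > 0\<close> pq by simp
  then obtain k u where ku: "p = 2 ^ k * u" "odd u"
    using power_of_two_times_odd by blast
  have N: "N = 2 ^ k * (u * q)" and "odd (u * q)" using pq ku by simp_all
  then obtain m where m: "u * q = 2 * m + 1" by (elim oddE)
  have "u * q \<ge> q" using \<open>odd u\<close> by (cases u) simp_all
  then have "m > 0" using m \<open>q \<ge> 2\<close> by simp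
  have "k \<noteq> 0"
  proof
    assume "k = 0"
    then show False using N \<open>even N\<close> \<open>odd (u * q)\<close> by simp
  qed
  moreover have "k \<noteq> 1"
  proof
    assume "k = 1"
    then have "2 * 2 dvd 2 * (u * q)" using N \<open>4 dvd N\<close> by simp
    then have "even (u * q)" by (simp only: nat_mult_dvd_cancel_disj) simp
    then show False using \<open>odd (u * q)\<close> by simp
  qed
  ultimately obtain n where "k = n + 1" "n > 0"
    by (cases k) auto
  then show "N \<in> {2 ^ (n + 1) * (2 * m + 1) | m n :: nat. m > 0 \<and> n > 0}"
    using N \<open>m > 0\<close> unfolding m by blast
next
  fix N :: nat
  assume "N \<in> {2 ^ (n + 1) * (2 * m + 1) | m n :: nat. m > 0 \<and> n > 0}"
  then obtain m n :: nat where N: "N = 2 ^ (n + 1) * (2 * m + 1)" and "m > 0" "n > 0"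
    by blast
  define s where "s = 2 ^ n * (2 * m + 1)"
  have "N = 2 * s" using N by (simp add: s_def)
  moreover have "even s" using \<open>n > 0\<close> by (simp add: s_def)
  moreover have "s > 0" by (simp add: s_def)
  moreover have "2 \<le> s" using \<open>even s\<close> \<open>s > 0\<close> by (cases "s = 1") simp_all
  ultimately have odds: "sum_successive_odds N"
    unfolding sum_successive_odds_iff by (intro exI[of _ 2] exI[of _ s]) simp
  define p q :: nat where "p = 2 ^ (n + 1)" and "q = 2 * m + 1"
  have pq: "N = p * q" "even p" "odd q" "2 \<le> p" "2 \<le> q"
    using N \<open>m > 0\<close> by (simp_all add: p_def q_def)
  have evens: "sum_successive_evens N"
  proof (cases "p \<le> q")
    case True
    then show ?thesis unfolding sum_successive_evens_iff using pq by blast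
  next
    case False
    then have "N = q * p \<and> 2 \<le> q \<and> q \<le> p \<and> (even q \<longleftrightarrow> odd p)"
      using pq by (simp add: mult.commute)
    then show ?thesis unfolding sum_successive_evens_iff by blast
  qed
  show "N \<in> {N. N > 0 \<and> sum_successive_odds N \<and> sum_successive_evens N}"
    using odds evens N by simp
qed

end
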